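(* Let $X$ be a real normed space, let $\ell_1,\ldots,\ell_m\in X^*$ and $L(f)=[\ell_1(f);\ldots;\ell_m(f)]\in\mathbb{R}^m$ for $f\in X$. Let $V\subseteq X$ be a linear subspace with $\dim(V)\le m$, let $\varepsilon>0$, $\eta>0$, $p\in[1,\infty]$, let $p'$ be the conjugate exponent ($1/p+1/p'=1$), and set $$\mathcal{K}=\{f\in X:\mathrm{dist}_X(f,V)\le\varepsilon\},\qquad \mathcal{E}=\{e\in\mathbb{R}^m:\|e\|_p\le\eta\}.$$ Let $Q:X\to\mathbb{R}$ be a continuous linear functional. If $a^{\rm opt}\in\mathbb{R}^m$ is a solution to $$\underset{a\in\mathbb{R}^m}{\text{minimize}}\ \Big\|Q-\sum_{i=1}^m a_i\ell_i\Big\|_{X^*}+\frac{\eta}{\varepsilon}\|a\|_{p'}\quad\text{subject to}\quad\sum_{i=1}^m a_i\ell_i(v)=Q(v)\ \text{ for all }v\in V,$$ then the linear map $R^{\rm opt}:y\in\mathbb{R}^m\mapsto\sum_{i=1}^m a_i^{\rm opt}y_i\in\mathbb{R}$ is an optimal recovery map over $\mathcal{K}$ and $\mathcal{E}$, i.e., $$\sup_{f\in\mathcal{K},\,e\in\mathcal{E}}|Q(f)-R^{\rm opt}(L(f)+e)|=\inf_{R:\mathbb{R}^m\to\mathbb{R}}\ \sup_{f\in\mathcal{K},\,e\in\mathcal{E}}|Q(f)-R(L(f)+e)|,$$ the infimum being over all (not necessarily linear) maps $R:\mathbb{R}^m\to\mathbb{R}$.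
   Context: $\mathrm{dist}_X(f,V)=\inf_{v\in V}\|f-v\|_X$; $X^*$ is the space of continuous linear functionals on $X$ with the dual norm $\|\cdot\|_{X^*}$. *)

theory Defs
  imports "HOL-Analysis.Analysis"
begin

text \<open>The exponent ranges over \<open>{1..\<infinity>}\<close>; the value for exponents below 1 is irrelevant.\<close>
definition lp_norm :: "ereal \<Rightarrow> real ^ 'm \<Rightarrow> real" where
  "lp_norm p x =
     (if p = \<infinity> then Max (range (\<lambda>i. \<bar>x $ i\<bar>))
      else (\<Sum>i\<in>UNIV. \<bar>x $ i\<bar> powr real_of_ereal p) powr (1 / real_of_ereal p))"

definition observation :: "('m \<Rightarrow> 'a::real_normed_vector \<Rightarrow>\<^sub>L real) \<Rightarrow> 'a \<Rightarrow> real ^ 'm" where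
  "observation l f = (\<chi> i. blinfun_apply (l i) f)"

definition model_set :: "'a::real_normed_vector set \<Rightarrow> real \<Rightarrow> 'a set" where
  "model_set V \<epsilon> = {f. infdist f V \<le> \<epsilon>}"

definition uncertainty_set :: "ereal \<Rightarrow> real \<Rightarrow> (real ^ 'm) set" where
  "uncertainty_set p \<eta> = {e. lp_norm p e \<le> \<eta>}"

text \<open>The supremum is taken in the extended reals, since for a general recovery map it may be
  infinite.\<close>
definition worst_case_error ::
  "('a::real_normed_vector \<Rightarrow>\<^sub>L real) \<Rightarrow> ('m \<Rightarrow> 'a \<Rightarrow>\<^sub>L real) \<Rightarrow> 'a set \<Rightarrow> (real ^ 'm) set
     \<Rightarrow> (real ^ 'm \<Rightarrow> real) \<Rightarrow> ereal" where
  "worst_case_error Q l K E R =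
     (SUP (f, e)\<in>K \<times> E. ereal \<bar>blinfun_apply Q f - R (observation l f + e)\<bar>)"

definition optimal_recovery_map ::
  "('a::real_normed_vector \<Rightarrow>\<^sub>L real) \<Rightarrow> ('m \<Rightarrow> 'a \<Rightarrow>\<^sub>L real) \<Rightarrow> 'a set \<Rightarrow> (real ^ 'm) set
     \<Rightarrow> (real ^ 'm \<Rightarrow> real) \<Rightarrow> bool" where
  "optimal_recovery_map Q l K E R \<longleftrightarrow>
     worst_case_error Q l K E R = (INF R'. worst_case_error Q l K E R')"

end

theory Submission imports Defs begin

text \<open>If a recovery map has worst-case error at most \<open>M\<close>, comparing the data \<open>(f, -L f)\<close> and
  \<open>(-f, L f)\<close>, which both produce the observation \<open>0\<close>, gives \<open>\<bar>Q f\<bar> \<le> M\<close> for all \<open>f \<in> \<K>\<close> with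
  \<open>L f \<in> \<E>\<close>. Hence the origin is not in the convex set of all \<open>(w - L f, t)\<close> with
  \<open>f \<in> cball 0 \<epsilon> + V\<close>, \<open>w \<in> \<E>\<close> and \<open>t > M - Q f\<close>, and a hyperplane separating it from the
  origin yields a feasible \<open>a\<close> whose objective value, multiplied by \<open>\<epsilon>\<close>, is at most \<open>M\<close>. The
  separation happens in \<open>\<real>\<^sup>m \<times> \<real>\<close>, so no infinite-dimensional Hahn--Banach theorem is needed.
  Conversely, by Hoelder's inequality the linear map given by a feasible \<open>a\<close> has worst-case error
  at most \<open>\<epsilon>\<close> times its objective value.\<close>

section \<open>Elementary properties of the p-norms on \<open>real ^ 'm\<close>\<close>

lemma lp_norm_infinity: "lp_norm \<infinity> x = Max (range (\<lambda>i. \<bar>x $ i\<bar>))"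
  by (simp add: lp_norm_def)

lemma lp_norm_ereal:
  "lp_norm (ereal r) x = (\<Sum>i\<in>UNIV. \<bar>x $ i\<bar> powr r) powr (1 / r)"
  by (simp add: lp_norm_def)

lemma lp_norm_one: "lp_norm 1 x = (\<Sum>i\<in>UNIV. \<bar>x $ i\<bar>)"
  by (simp add: lp_norm_def one_ereal_def sum_nonneg)

lemma component_le_lp_norm_infinity: "\<bar>x $ i\<bar> \<le> lp_norm \<infinity> x"
  by (simp add: lp_norm_infinity)

lemma lp_norm_nonneg: "0 \<le> lp_norm p x"
proof (cases "p = \<infinity>")
  case True
  have "0 \<le> \<bar>x $ undefined\<bar>" by simp
  also have "\<dots> \<le> lp_norm \<infinity> x" by (rule component_le_lp_norm_infinity)
  finally show ?thesis by (simp add: True)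
qed (simp add: lp_norm_def)

lemma lp_norm_eq_0D:
  assumes "1 \<le> p" "lp_norm p x = 0"
  shows "x = 0"
proof (cases p)
  case (real r)
  then have "(\<Sum>i\<in>UNIV. \<bar>x $ i\<bar> powr r) = 0"
    using assms by (simp add: lp_norm_ereal)
  then show ?thesis
    by (simp add: sum_nonneg_eq_0_iff vec_eq_iff)
next
  case PInf
  then show ?thesis
    using component_le_lp_norm_infinity[of x] assms by (simp add: vec_eq_iff)
qed (use assms in auto)

lemma lp_norm_scaleR:
  assumes "1 \<le> p"
  shows "lp_norm p (c *\<^sub>R x) = \<bar>c\<bar> * lp_norm p x"
proof (cases p)
  case (real r)
  then have "r > 0" using assms by (simp add: one_ereal_def)
  then show ?thesis
    by (simp add: real lp_norm_ereal abs_mult powr_mult sum_nonneg powr_powr flip: sum_distrib_left)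
next
  case PInf
  \<comment> \<open>Multiplication by the nonnegative \<open>\<bar>c\<bar>\<close> is monotone, so
    it commutes with the maximum of a finite nonempty set.\<close>
  have "Max (range (\<lambda>i. \<bar>c\<bar> * \<bar>x $ i\<bar>)) = \<bar>c\<bar> * Max (range (\<lambda>i. \<bar>x $ i\<bar>))"
    using mono_Max_commute[of "\<lambda>t. \<bar>c\<bar> * t" "range (\<lambda>i. \<bar>x $ i\<bar>)"]
    by (simp add: mono_def mult_left_mono image_image)
  then show ?thesis
    by (simp add: PInf lp_norm_infinity abs_mult)
qed (use assms in auto)

section \<open>Hoelder duality between conjugate exponents\<close>

text \<open>As \<open>1 / \<infinity> = 0\<close>, an endpoint exponent forces its conjugate to be
  the opposite endpoint. Powers and Young's inequality are thus confined to finite exponents above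
  1.\<close>

lemma conjugate_exponents_cases:
  fixes p q :: ereal
  assumes "1 \<le> p" "1 \<le> q" "1 / p + 1 / q = 1"
  obtains "p = 1" "q = \<infinity>" | "p = \<infinity>" "q = 1"
    | r s where "p = ereal r" "q = ereal s" "1 < r" "1 < s" "1 / r + 1 / s = 1"
proof (cases p; cases q)
  fix r s
  assume pq: "p = ereal r" "q = ereal s"
  then have rs: "1 \<le> r" "1 \<le> s" using assms by (auto simp: one_ereal_def)
  then have "1 / r + 1 / s = 1"
    using assms(3) by (simp add: pq one_ereal_def)
  moreover from this rs have "r \<noteq> 1" "s \<noteq> 1" by auto
  ultimately show thesis using that(3) pq rs by auto
next
  fix r
  assume pq: "p = ereal r" "q = \<infinity>"
  then have "r = 1" using assms by (auto simp: one_ereal_def)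
  then show thesis using that(1) pq by (simp add: one_ereal_def)
next
  fix s
  assume pq: "p = \<infinity>" "q = ereal s"
  then have "s = 1" using assms by (auto simp: one_ereal_def)
  then show thesis using that(2) pq by (simp add: one_ereal_def)
qed (use assms in auto)

lemma inner_le_lp_norm_one_infinity: "x \<bullet> y \<le> lp_norm 1 x * lp_norm \<infinity> y"
proof -
  have "x \<bullet> y \<le> (\<Sum>i\<in>UNIV. \<bar>x $ i\<bar> * \<bar>y $ i\<bar>)"
    unfolding inner_vec_def by (intro sum_mono) (simp flip: abs_mult)
  also have "\<dots> \<le> (\<Sum>i\<in>UNIV. \<bar>x $ i\<bar> * lp_norm \<infinity> y)"
    by (intro sum_mono mult_left_mono component_le_lp_norm_infinity) simp
  finally show ?thesis by (simp add: lp_norm_one sum_distrib_right)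
qed

text \<open>Away from the endpoints, Young's inequality is applied coordinatewise to the vectors
  divided by their norms; the resulting bounds add up to \<open>1 / r + 1 / s = 1\<close>.\<close>

lemma Holder_inequality_lp_norm:
  fixes x y :: "real ^ 'm"
  assumes "1 \<le> p" "1 \<le> q" "1 / p + 1 / q = 1"
  shows "x \<bullet> y \<le> lp_norm p x * lp_norm q y"
  using assms
proof (cases rule: conjugate_exponents_cases)
  case 1
  then show ?thesis by (simp add: inner_le_lp_norm_one_infinity)
next
  case 2
  then show ?thesis by (metis inner_commute inner_le_lp_norm_one_infinity mult.commute)
next
  case (3 r s)
  let ?X = "lp_norm p x" and ?Y = "lp_norm q y"
  show ?thesis
  proof (cases "x = 0 \<or> y = 0")
    case True
    then show ?thesis by (auto simp: lp_norm_nonneg)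
  next
    case False
    then have pos: "?X > 0" "?Y > 0"
      using assms lp_norm_nonneg lp_norm_eq_0D by (metis less_eq_real_def)+
    have powr_norm: "?X powr r = (\<Sum>i\<in>UNIV. \<bar>x $ i\<bar> powr r)" "?Y powr s = (\<Sum>i\<in>UNIV. \<bar>y $ i\<bar> powr s)"
      using 3 by (simp_all add: lp_norm_ereal powr_powr sum_nonneg)
    have "x \<bullet> y / (?X * ?Y) \<le> (\<Sum>i\<in>UNIV. \<bar>x $ i\<bar> / ?X * (\<bar>y $ i\<bar> / ?Y))"
      unfolding inner_vec_def sum_divide_distrib
      using pos by (intro sum_mono) (simp add: divide_right_mono flip: abs_mult)
    also have "\<dots> \<le> (\<Sum>i\<in>UNIV. (\<bar>x $ i\<bar> / ?X) powr r / r + (\<bar>y $ i\<bar> / ?Y) powr s / s)"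
      using 3 pos by (intro sum_mono Youngs_inequality) auto
    also have "\<dots> = (\<Sum>i\<in>UNIV. \<bar>x $ i\<bar> powr r) / ?X powr r / r + (\<Sum>i\<in>UNIV. \<bar>y $ i\<bar> powr s) / ?Y powr s / s"
      using pos by (simp add: sum.distrib sum_divide_distrib powr_divide)
    also have "\<dots> = 1"
      using pos 3(5) by (simp flip: powr_norm)
    finally show ?thesis using pos by (simp add: divide_le_eq)
  qed
qed

text \<open>Hoelder's inequality is sharp: the dual norm is attained on the unit ball. Suprema over
  the ball can therefore be replaced by the value at a single vector.\<close>

lemma lp_norm_norming_vector:
  fixes a :: "real ^ 'm"
  assumes "1 \<le> p" "1 \<le> q" "1 / p + 1 / q = 1"
  obtains w where "lp_norm p w \<le> 1" "a \<bullet> w = lp_norm q a"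
  using assms
proof (cases rule: conjugate_exponents_cases)
  case 1
  have "lp_norm q a \<in> range (\<lambda>i. \<bar>a $ i\<bar>)"
    unfolding 1 lp_norm_infinity by (rule Max_in) auto
  then obtain i where i: "lp_norm q a = \<bar>a $ i\<bar>" by auto
  \<comment> \<open>A signed unit vector at a coordinate of largest modulus; it is 0 when
    \<open>a = 0\<close>, hence only a bound by 1 on its norm.\<close>
  let ?w = "axis i (sgn (a $ i))"
  have "lp_norm p ?w = (\<Sum>j\<in>UNIV. if j = i then \<bar>sgn (a $ i)\<bar> else 0)"
    unfolding 1 lp_norm_one by (intro sum.cong) (auto simp: axis_def)
  also have "\<dots> \<le> 1" by (simp add: abs_sgn_eq)
  finally have "lp_norm p ?w \<le> 1" .
  moreover have "a \<bullet> ?w = lp_norm q a"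
    by (simp add: i inner_axis abs_sgn)
  ultimately show thesis by (rule that)
next
  case 2
  let ?w = "\<chi> i. sgn (a $ i)"
  have "lp_norm p ?w \<le> 1"
    by (auto simp: 2 lp_norm_infinity abs_sgn_eq)
  moreover have "a \<bullet> ?w = lp_norm q a"
    by (simp add: 2 lp_norm_one inner_vec_def abs_sgn)
  ultimately show thesis by (rule that)
next
  case (3 r s)
  let ?A = "lp_norm q a"
  show thesis
  proof (cases "a = 0")
    case True
    then have "?A = 0" using lp_norm_scaleR[of q 0 a] assms by simp
    moreover have "lp_norm p (0 :: real ^ 'm) \<le> 1" using lp_norm_scaleR[of p 0 a] assms by simp
    ultimately show thesis using that True by simp
  next
    case False
    then have pos: "?A > 0"
      using assms lp_norm_nonneg lp_norm_eq_0D by (metis less_eq_real_def)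
    have A: "?A powr s = (\<Sum>i\<in>UNIV. \<bar>a $ i\<bar> powr s)"
      using 3 by (simp add: lp_norm_ereal powr_powr sum_nonneg)
    have rs: "(s - 1) * r = s"
      using 3 by (simp add: field_simps)
    \<comment> \<open>Equality in Young's inequality asks for the \<open>r\<close>-th power of the
      entries of \<open>?w\<close> to be proportional to the \<open>s\<close>-th power of those of
      \<open>a\<close>; by \<open>rs\<close> the exponent must be \<open>s - 1\<close>.\<close>
    let ?w = "\<chi> i. sgn (a $ i) * (\<bar>a $ i\<bar> / ?A) powr (s - 1)"
    have "\<bar>?w $ i\<bar> powr r = \<bar>a $ i\<bar> powr s / ?A powr s" for i
      using pos rs by (cases "a $ i = 0") (simp_all add: abs_mult abs_sgn_eq powr_powr powr_divide)
    then have "(\<Sum>i\<in>UNIV. \<bar>?w $ i\<bar> powr r) = (\<Sum>i\<in>UNIV. \<bar>a $ i\<bar> powr s) / ?A powr s"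
      unfolding sum_divide_distrib by (intro sum.cong refl)
    also have "\<dots> = 1"
      using pos unfolding A[symmetric] by simp
    finally have "lp_norm p ?w = 1"
      unfolding \<open>p = ereal r\<close> lp_norm_ereal by simp
    moreover have "a $ i * ?w $ i = \<bar>a $ i\<bar> powr s / ?A powr (s - 1)" for i
    proof -
      have "\<bar>a $ i\<bar> * \<bar>a $ i\<bar> powr (s - 1) = \<bar>a $ i\<bar> powr s"
        by (cases "a $ i = 0") (simp_all add: powr_mult_base)
      then show ?thesis
        using pos by (simp add: powr_divide abs_sgn mult.assoc[symmetric])
    qed
    then have "a \<bullet> ?w = ?A powr s / ?A powr (s - 1)"
      by (simp add: inner_vec_def A sum_divide_distrib)
    then have "a \<bullet> ?w = ?A"
      using pos by (simp flip: powr_diff)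
    ultimately show thesis using that by (metis order_refl)
  qed
qed

lemma lp_norm_norming_vector_radius:
  fixes a :: "real ^ 'm"
  assumes "1 \<le> p" "1 \<le> q" "1 / p + 1 / q = 1" "0 \<le> \<eta>"
  obtains w where "w \<in> uncertainty_set p \<eta>" "a \<bullet> w = \<eta> * lp_norm q a"
proof -
  obtain w where "lp_norm p w \<le> 1" "a \<bullet> w = lp_norm q a"
    using lp_norm_norming_vector assms(1-3) .
  then show thesis
    using that[of "\<eta> *\<^sub>R w"] assms
    by (simp add: uncertainty_set_def lp_norm_scaleR mult_left_le)
qed

text \<open>A vector \<open>w\<close> that norms the convex combination turns its p-norm into a
  linear functional, and Hoelder's inequality bounds this functional by \<open>\<eta>\<close> at
  both given points.\<close>

lemma convex_uncertainty_set:
  assumes "1 \<le> p" "1 \<le> q" "1 / p + 1 / q = 1"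
  shows "convex (uncertainty_set p \<eta> :: (real ^ 'm) set)"
proof (rule convexI)
  fix x y :: "real ^ 'm" and u v :: real
  assume x: "x \<in> uncertainty_set p \<eta>" and y: "y \<in> uncertainty_set p \<eta>"
    and uv: "0 \<le> u" "0 \<le> v" "u + v = 1"
  \<comment> \<open>The exponents are swapped: here \<open>w\<close> lies in the unit ball for
    \<open>q\<close> and norms a vector for \<open>p\<close>.\<close>
  have "1 / q + 1 / p = 1" using assms by (simp add: add.commute)
  then obtain w where w: "lp_norm q w \<le> 1" "(u *\<^sub>R x + v *\<^sub>R y) \<bullet> w = lp_norm p (u *\<^sub>R x + v *\<^sub>R y)"
    using lp_norm_norming_vector assms(1,2) by blast
  have le: "z \<bullet> w \<le> \<eta>" if "z \<in> uncertainty_set p \<eta>" for z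
  proof -
    have "z \<bullet> w \<le> lp_norm p z * lp_norm q w"
      by (rule Holder_inequality_lp_norm[OF assms])
    also have "\<dots> \<le> lp_norm p z"
      using w(1) by (simp add: lp_norm_nonneg mult_left_le)
    finally show ?thesis using that by (simp add: uncertainty_set_def)
  qed
  have "u * (x \<bullet> w) + v * (y \<bullet> w) \<le> u * \<eta> + v * \<eta>"
    using le x y uv by (intro add_mono mult_left_mono) auto
  then show "u *\<^sub>R x + v *\<^sub>R y \<in> uncertainty_set p \<eta>"
    using w(2) uv(3) by (simp add: uncertainty_set_def inner_add_left flip: distrib_right)
qed

lemma uncertainty_set_uminus:
  assumes "1 \<le> p" "e \<in> uncertainty_set p \<eta>"
  shows "- e \<in> uncertainty_set p \<eta>"
  using assms lp_norm_scaleR[of p "-1" e] by (simp add: uncertainty_set_def)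

section \<open>The observation map and the error of a feasible linear recovery\<close>

lemma linear_observation: "linear (observation l)"
  by (intro linearI) (simp_all add: observation_def vec_eq_iff blinfun.add_right blinfun.scaleR_right)

lemma inner_observation:
  "a \<bullet> observation l f = blinfun_apply (\<Sum>i\<in>UNIV. (a $ i) *\<^sub>R l i) f"
  by (simp add: inner_vec_def observation_def blinfun.sum_left blinfun.scaleR_left)

text \<open>As \<open>D\<close> vanishes on \<open>V\<close>, \<open>D f = D (f - v)\<close> for
  every \<open>v\<close> in \<open>V\<close>; the infimum over \<open>v\<close> of the norm bounds
  gives the claim.\<close>

lemma abs_blinfun_le_norm_infdist:
  assumes "V \<noteq> {}" "\<And>v. v \<in> V \<Longrightarrow> blinfun_apply D v = (0 :: real)"
  shows "\<bar>blinfun_apply D f\<bar> \<le> norm D * infdist f V"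
proof (cases "norm D = 0")
  case False
  have "\<bar>blinfun_apply D f\<bar> / norm D \<le> infdist f V"
    unfolding infdist_notempty[OF assms(1)]
  proof (rule cINF_greatest[OF assms(1)])
    fix v assume "v \<in> V"
    then have "\<bar>blinfun_apply D f\<bar> = norm (blinfun_apply D (f - v))"
      using assms(2) by (simp add: blinfun.diff_right)
    also have "\<dots> \<le> norm D * dist f v"
      unfolding dist_norm by (rule norm_blinfun)
    finally show "\<bar>blinfun_apply D f\<bar> / norm D \<le> dist f v"
      using False by (simp add: divide_le_eq mult.commute)
  qed
  then show ?thesis using False by (simp add: divide_le_eq mult.commute)
qed simp

text \<open>Feasibility makes the residual \<open>?D\<close> vanish on \<open>V\<close>. The error
  is \<open>?D f - a \<bullet> e\<close>: the distance to \<open>V\<close> controls the first term,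
  Hoelder's inequality the second.\<close>

lemma worst_case_error_linear_le:
  fixes l :: "'m::finite \<Rightarrow> 'a::real_normed_vector \<Rightarrow>\<^sub>L real" and a :: "real ^ 'm"
  assumes "V \<noteq> {}"
    and pq: "1 \<le> p" "1 \<le> q" "1 / p + 1 / q = 1"
    and feasible: "\<And>v. v \<in> V \<Longrightarrow> a \<bullet> observation l v = blinfun_apply Q v"
  shows "worst_case_error Q l (model_set V \<epsilon>) (uncertainty_set p \<eta>) (\<lambda>y. a \<bullet> y)
    \<le> ereal (\<epsilon> * norm (Q - (\<Sum>i\<in>UNIV. (a $ i) *\<^sub>R l i)) + \<eta> * lp_norm q a)"
  unfolding worst_case_error_def
proof (rule SUP_least, clarify)
  fix f and e :: "real ^ 'm"
  assume f: "f \<in> model_set V \<epsilon>" and e: "e \<in> uncertainty_set p \<eta>"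
  let ?D = "Q - (\<Sum>i\<in>UNIV. (a $ i) *\<^sub>R l i)"
  have D: "blinfun_apply ?D x = blinfun_apply Q x - a \<bullet> observation l x" for x
    by (simp add: inner_observation blinfun.diff_left)
  have "\<bar>blinfun_apply ?D f\<bar> \<le> norm ?D * infdist f V"
    using feasible D by (intro abs_blinfun_le_norm_infdist assms(1)) simp
  also have "\<dots> \<le> norm ?D * \<epsilon>"
    using f by (intro mult_left_mono) (auto simp: model_set_def)
  finally have "\<bar>blinfun_apply ?D f\<bar> \<le> \<epsilon> * norm ?D" by (simp add: mult.commute)
  moreover have "e' \<bullet> a \<le> \<eta> * lp_norm q a" if "e' \<in> uncertainty_set p \<eta>" for e'
    using Holder_inequality_lp_norm[OF pq, of e' a] that lp_norm_nonneg[of q a]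
    by (simp add: uncertainty_set_def) (meson mult_right_mono order_trans)
  from this[OF e] this[OF uncertainty_set_uminus[OF pq(1) e]]
  have "\<bar>a \<bullet> e\<bar> \<le> \<eta> * lp_norm q a"
    by (simp add: inner_commute abs_le_iff)
  moreover have "blinfun_apply Q f - a \<bullet> (observation l f + e) = blinfun_apply ?D f - a \<bullet> e"
    by (simp add: D inner_add_right)
  ultimately show "ereal \<bar>blinfun_apply Q f - a \<bullet> (observation l f + e)\<bar>
      \<le> ereal (\<epsilon> * norm ?D + \<eta> * lp_norm q a)"
    by simp
qed

section \<open>The lower bound by separation\<close>

text \<open>A one-sided bound suffices because the ball is symmetric; homogeneity carries it from
  radius \<open>\<epsilon>\<close> to all vectors.\<close>

lemma scaled_norm_blinfun_le:
  fixes D :: "'a::real_normed_vector \<Rightarrow>\<^sub>L real"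
  assumes "0 < \<epsilon>" "\<And>x. norm x \<le> \<epsilon> \<Longrightarrow> blinfun_apply D x \<le> C"
  shows "\<epsilon> * norm D \<le> C"
proof -
  have C: "0 \<le> C" using assms(2)[of 0] assms(1) by simp
  have le: "blinfun_apply D x \<le> C / \<epsilon> * norm x" for x
  proof (cases "x = 0")
    case False
    then have "blinfun_apply D ((\<epsilon> / norm x) *\<^sub>R x) \<le> C"
      using assms by (intro assms(2)) simp
    then show ?thesis
      using False assms(1) by (simp add: blinfun.scaleR_right field_simps)
  qed simp
  have "norm D \<le> C / \<epsilon>"
    using C assms(1) le le[of "- x" for x]
    by (intro norm_blinfun_bound) (simp_all add: blinfun.minus_right abs_le_iff)
  then show ?thesis using assms(1) by (simp add: field_simps)
qed

lemma feasible_of_recovery_bound: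
  fixes l :: "'m::finite \<Rightarrow> 'a::real_normed_vector \<Rightarrow>\<^sub>L real"
  assumes V: "subspace V" and "0 < \<epsilon>" "0 < \<eta>"
    and pq: "1 \<le> p" "1 \<le> q" "1 / p + 1 / q = 1"
    and bound: "\<And>f e. f \<in> model_set V \<epsilon> \<Longrightarrow> e \<in> uncertainty_set p \<eta> \<Longrightarrow>
      \<bar>blinfun_apply Q f - R (observation l f + e)\<bar> \<le> M"
  obtains a where "\<And>v. v \<in> V \<Longrightarrow> a \<bullet> observation l v = blinfun_apply Q v"
    and "\<epsilon> * norm (Q - (\<Sum>i\<in>UNIV. (a $ i) *\<^sub>R l i)) + \<eta> * lp_norm q a \<le> M"
proof -
  interpret L: linear "observation l" by (rule linear_observation)
  let ?E = "uncertainty_set p \<eta> :: (real ^ 'm) set"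
  \<comment> \<open>A convex subset of the model set: \<open>x + v\<close> is within
    \<open>\<epsilon>\<close> of \<open>v\<close>. The inclusion suffices for \<open>bound\<close>
    to apply.\<close>
  let ?K = "{x + v |x v. x \<in> cball 0 \<epsilon> \<and> v \<in> V}"
  define S where "S = {(w - observation l f, t) |w f t. w \<in> ?E \<and> f \<in> ?K \<and> M - blinfun_apply Q f < t}"
  have "?K = (\<Union>x\<in>cball 0 \<epsilon>. \<Union>v\<in>V. {x + v})" by blast
  then have cK: "convex ?K"
    by (simp only: convex_sums[OF convex_cball subspace_imp_convex[OF V]])
  have cE: "convex ?E" by (rule convex_uncertainty_set[OF pq])
  have "convex S"
  proof (rule convexI)
    fix z z' and u v :: real
    assume "z \<in> S" "z' \<in> S" and uv: "0 \<le> u" "0 \<le> v" "u + v = 1"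
    then obtain w f t w' f' t' where
      z: "z = (w - observation l f, t)" "w \<in> ?E" "f \<in> ?K" "M - blinfun_apply Q f < t" and
      z': "z' = (w' - observation l f', t')" "w' \<in> ?E" "f' \<in> ?K" "M - blinfun_apply Q f' < t'"
      unfolding S_def by blast
    have "u * (M - blinfun_apply Q f) + v * (M - blinfun_apply Q f') < u * t + v * t'"
    \<comment> \<open>Strictness must come from a term of positive weight: the first one, unless
      \<open>u = 0\<close> and hence \<open>v = 1\<close>.\<close>
    proof (cases "u = 0")
      case False
      then show ?thesis
        using uv z(4) z'(4) by (intro add_less_le_mono mult_strict_left_mono mult_left_mono) auto
    qed (use uv z'(4) in simp)
    moreover have "u * (M - blinfun_apply Q f) + v * (M - blinfun_apply Q f')
      = (u + v) * M - blinfun_apply Q (u *\<^sub>R f + v *\<^sub>R f')"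
      by (simp add: blinfun.add_right blinfun.scaleR_right algebra_simps)
    ultimately have "M - blinfun_apply Q (u *\<^sub>R f + v *\<^sub>R f') < u * t + v * t'"
      using uv by simp
    moreover have "u *\<^sub>R w + v *\<^sub>R w' \<in> ?E"
      using convexD[OF cE z(2) z'(2) uv] .
    moreover have "u *\<^sub>R f + v *\<^sub>R f' \<in> ?K"
      using convexD[OF cK z(3) z'(3) uv] .
    moreover have "u *\<^sub>R z + v *\<^sub>R z' = (u *\<^sub>R w + v *\<^sub>R w' - observation l (u *\<^sub>R f + v *\<^sub>R f'), u * t + v * t')"
      by (simp add: z z' L.add L.scale algebra_simps)
    ultimately show "u *\<^sub>R z + v *\<^sub>R z' \<in> S"
      unfolding S_def by blast
  qed
  moreover have "0 \<notin> S"
  proof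
    assume "0 \<in> S"
    then obtain f where f: "f \<in> ?K" "observation l f \<in> ?E" "M < blinfun_apply Q f"
      unfolding S_def zero_prod_def by auto
    from f(1) obtain x v where xv: "f = x + v" "norm x \<le> \<epsilon>" "v \<in> V" by auto
    have "f \<in> model_set V \<epsilon>"
      using xv by (auto simp: model_set_def dist_norm intro: infdist_le2)
    moreover have "- f \<in> model_set V \<epsilon>"
      unfolding model_set_def using xv subspace_neg[OF V xv(3)]
      by (auto simp: dist_norm intro!: infdist_le2[of "- v"])
    ultimately have "\<bar>blinfun_apply Q f - R 0\<bar> \<le> M" "\<bar>- blinfun_apply Q f - R 0\<bar> \<le> M"
      using bound[of f "- observation l f"] bound[of "- f" "observation l f"]
        f(2) uncertainty_set_uminus[OF pq(1) f(2)]
      by (simp_all add: L.neg blinfun.minus_right)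
    \<comment> \<open>Adding the two estimates eliminates the unknown value
      \<open>R 0\<close>.\<close>
    then show False using f(3) by linarith
  qed
  ultimately obtain c where "c \<noteq> 0" "\<forall>z\<in>S. 0 \<le> c \<bullet> z"
    using separating_hyperplane_set_0 by blast
  then obtain \<alpha> \<beta> where nz: "(\<alpha>, \<beta>) \<noteq> 0" and sep: "\<And>z. z \<in> S \<Longrightarrow> 0 \<le> (\<alpha>, \<beta>) \<bullet> z"
    by (metis surj_pair)
  have sep: "0 \<le> \<alpha> \<bullet> (w - observation l f) + \<beta> * t"
    if "w \<in> ?E" "f \<in> ?K" "M - blinfun_apply Q f < t" for w f t
    using sep[of "(w - observation l f, t)"] that unfolding S_def by auto
  have K0: "x + v \<in> ?K" if "norm x \<le> \<epsilon>" "v \<in> V" for x v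
    using that by (simp add: conj_commute) blast
  have 0: "0 \<in> ?K" using K0[of 0 0] assms subspace_0[OF V] by simp
  have E0: "0 \<in> ?E"
    using lp_norm_scaleR[OF pq(1), of 0 "0 :: real ^ 'm"] assms(3) by (simp add: uncertainty_set_def)
  \<comment> \<open>The height \<open>\<bar>M\<bar> + 1\<close> is positive and exceeds
    \<open>M = M - Q 0\<close>, so it reveals the sign of \<open>\<beta>\<close>.\<close>
  have "0 \<le> \<beta> * (\<bar>M\<bar> + 1)"
    using sep[OF E0 0, of "\<bar>M\<bar> + 1"] by (simp add: L.zero)
  then have "0 \<le> \<beta>" by (auto simp: zero_le_mult_iff)
  \<comment> \<open>A vertical hyperplane is impossible: \<open>\<alpha>\<close> would be
    nonnegative on the ball \<open>?E\<close>, yet it takes the value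
    \<open>- \<eta> * lp_norm q (- \<alpha>)\<close> there. This would force
    \<open>\<alpha> = 0\<close>, against \<open>nz\<close>.\<close>
  moreover have "\<beta> \<noteq> 0"
  proof
    assume "\<beta> = 0"
    obtain w where w: "w \<in> ?E" "(- \<alpha>) \<bullet> w = \<eta> * lp_norm q (- \<alpha>)"
      using lp_norm_norming_vector_radius[OF pq, of \<eta> "- \<alpha>"] assms(3) by auto
    have "0 \<le> \<alpha> \<bullet> w"
      using sep[OF w(1) 0, of "M + 1"] \<open>\<beta> = 0\<close> by (simp add: L.zero)
    then have "\<eta> * lp_norm q (- \<alpha>) \<le> 0" using w(2) by simp
    then have "lp_norm q (- \<alpha>) = 0"
      using assms(3) lp_norm_nonneg[of q "- \<alpha>"] by (simp add: mult_le_0_iff)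
    then have "\<alpha> = 0" using lp_norm_eq_0D[OF pq(2)] by fastforce
    then show False using nz \<open>\<beta> = 0\<close> by (simp add: zero_prod_def)
  qed
  ultimately have \<beta>: "\<beta> > 0" by simp
  \<comment> \<open>Dividing by \<open>\<beta>\<close> normalizes the coefficient of
    \<open>t\<close> to 1; the sign makes \<open>Q - a \<bullet> L\<close> appear in
    \<open>key\<close>.\<close>
  define a where "a = (- 1 / \<beta>) *\<^sub>R \<alpha>"
  have \<alpha>: "\<alpha> = - (\<beta> *\<^sub>R a)" using \<beta> by (simp add: a_def)
  define D where "D = Q - (\<Sum>i\<in>UNIV. (a $ i) *\<^sub>R l i)"
  have D: "blinfun_apply D f = blinfun_apply Q f - a \<bullet> observation l f" for f
    by (simp add: D_def inner_observation blinfun.diff_left)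
  \<comment> \<open>Heights in \<open>S\<close> lie strictly above \<open>M - Q f\<close>, so the
    separation is used at \<open>M - Q f + d\<close> for arbitrary \<open>d > 0\<close>.\<close>
  have key: "blinfun_apply D f + a \<bullet> w \<le> M" if "w \<in> ?E" "f \<in> ?K" for w f
  proof (rule field_le_epsilon)
    fix d :: real assume "0 < d"
    then have "0 \<le> \<alpha> \<bullet> (w - observation l f) + \<beta> * (M - blinfun_apply Q f + d)"
      by (intro sep that) simp
    also have "\<dots> = \<beta> * (M + d - (blinfun_apply D f + a \<bullet> w))"
      using \<beta> by (simp add: D \<alpha> inner_diff_right algebra_simps)
    finally show "blinfun_apply D f + a \<bullet> w \<le> M + d"
      using \<beta> by (simp add: zero_le_mult_iff)
  qed
  \<comment> \<open>\<open>?K\<close> contains the whole line through \<open>v\<close>, on which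
    \<open>key\<close> bounds \<open>D\<close> above by \<open>M\<close>; the multiple of
    \<open>v\<close> where \<open>D\<close> equals \<open>M + 1\<close> contradicts this.\<close>
  have "blinfun_apply D v = 0" if "v \<in> V" for v
  proof (rule ccontr)
    assume nz: "blinfun_apply D v \<noteq> 0"
    have "0 + ((M + 1) / blinfun_apply D v) *\<^sub>R v \<in> ?K"
      using assms(2) subspace_scale[OF V that] by (intro K0) simp_all
    from key[OF E0 this] show False using nz by (simp add: blinfun.scaleR_right)
  qed
  then have "a \<bullet> observation l v = blinfun_apply Q v" if "v \<in> V" for v
    using that by (simp add: D)
  moreover have "\<epsilon> * norm D + \<eta> * lp_norm q a \<le> M"
  \<comment> \<open>In \<open>key\<close> the vectors \<open>w\<close> and \<open>f\<close> vary
    independently: \<open>w\<close> is fixed as a norming vector of \<open>a\<close>, and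
    \<open>f\<close> then runs through the ball of radius \<open>\<epsilon>\<close>.\<close>
  proof -
    obtain w where w: "w \<in> ?E" "a \<bullet> w = \<eta> * lp_norm q a"
      using lp_norm_norming_vector_radius[OF pq, of \<eta> a] assms(3) by auto
    have "blinfun_apply D x \<le> M - \<eta> * lp_norm q a" if "norm x \<le> \<epsilon>" for x
      using key[OF w(1) K0[OF that subspace_0[OF V]]] w(2) by simp
    from scaled_norm_blinfun_le[OF assms(2) this] show ?thesis by simp
  qed
  ultimately show thesis using that unfolding D_def by blast
qed

section \<open>Optimality of the minimizer from the two bounds\<close>

theorem theorem4:
  fixes l :: "'m::finite \<Rightarrow> 'a::real_normed_vector \<Rightarrow>\<^sub>L real"
    and V :: "'a set"
    and \<epsilon> \<eta> :: real
    and p p' :: ereal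
    and Q :: "'a \<Rightarrow>\<^sub>L real"
    and aopt :: "real ^ 'm"
  assumes "subspace V"
    and "\<exists>B. finite B \<and> V = span B"
    and "dim V \<le> CARD('m)"
    and "\<epsilon> > 0" and "\<eta> > 0"
    and "1 \<le> p" and "1 \<le> p'" and "1 / p + 1 / p' = 1"
    and "is_arg_min
           (\<lambda>a. norm (Q - (\<Sum>i\<in>UNIV. (a $ i) *\<^sub>R l i)) + \<eta> / \<epsilon> * lp_norm p' a)
           (\<lambda>a. \<forall>v\<in>V. (\<Sum>i\<in>UNIV. a $ i * blinfun_apply (l i) v) = blinfun_apply Q v)
           aopt"
  shows "linear (\<lambda>y :: real ^ 'm. \<Sum>i\<in>UNIV. aopt $ i * y $ i) \<and>
    optimal_recovery_map Q l (model_set V \<epsilon>) (uncertainty_set p \<eta>)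
      (\<lambda>y. \<Sum>i\<in>UNIV. aopt $ i * y $ i)"
proof
  have inner: "(\<Sum>i\<in>UNIV. a $ i * y $ i) = a \<bullet> y" for a y :: "real ^ 'm"
    by (simp add: inner_vec_def)
  show "linear (\<lambda>y :: real ^ 'm. \<Sum>i\<in>UNIV. aopt $ i * y $ i)"
    unfolding inner by (intro linearI) (simp_all add: inner_add_right)
  let ?K = "model_set V \<epsilon>" and ?E = "uncertainty_set p \<eta> :: (real ^ 'm) set"
  let ?err = "worst_case_error Q l ?K ?E"
  let ?obj = "\<lambda>a :: real ^ 'm. norm (Q - (\<Sum>i\<in>UNIV. (a $ i) *\<^sub>R l i)) + \<eta> / \<epsilon> * lp_norm p' a"
  have obs: "(\<Sum>i\<in>UNIV. a $ i * blinfun_apply (l i) v) = a \<bullet> observation l v" for a v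
    by (simp add: inner_vec_def observation_def)
  have feasible: "\<And>v. v \<in> V \<Longrightarrow> aopt \<bullet> observation l v = blinfun_apply Q v"
    and opt: "\<And>a. (\<And>v. v \<in> V \<Longrightarrow> a \<bullet> observation l v = blinfun_apply Q v) \<Longrightarrow> ?obj aopt \<le> ?obj a"
    using assms(9) unfolding is_arg_min_def obs by (auto simp: not_less)
  \<comment> \<open>Scaling by \<open>\<epsilon>\<close> turns the weight
    \<open>\<eta> / \<epsilon>\<close> into \<open>\<eta>\<close>, matching the objective with both
    error bounds.\<close>
  have scaled: "\<epsilon> * ?obj a = \<epsilon> * norm (Q - (\<Sum>i\<in>UNIV. (a $ i) *\<^sub>R l i)) + \<eta> * lp_norm p' a" for a
    using assms(4) by (simp add: distrib_left)
  have upper: "?err (\<lambda>y. aopt \<bullet> y) \<le> ereal (\<epsilon> * ?obj aopt)"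
    unfolding scaled using subspace_0[OF assms(1)] feasible
    by (intro worst_case_error_linear_le assms(6-8)) auto
  have lower: "ereal (\<epsilon> * ?obj aopt) \<le> ?err R" for R
  proof (cases "?err R")
    case (real M)
    have "\<bar>blinfun_apply Q f - R (observation l f + e)\<bar> \<le> M" if "f \<in> ?K" "e \<in> ?E" for f e
    proof -
      have "ereal \<bar>blinfun_apply Q f - R (observation l f + e)\<bar> \<le> ?err R"
        unfolding worst_case_error_def using that by (intro SUP_upper2[of "(f, e)"]) auto
      then show ?thesis by (simp add: real)
    qed
    then obtain a where "\<And>v. v \<in> V \<Longrightarrow> a \<bullet> observation l v = blinfun_apply Q v"
      "\<epsilon> * ?obj a \<le> M"
      using feasible_of_recovery_bound[OF assms(1,4-8)] unfolding scaled by blast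
    then have "\<epsilon> * ?obj aopt \<le> M"
      using mult_left_mono[OF opt] assms(4) by (meson less_imp_le order_trans)
    then show ?thesis by (simp add: real)
  next
    \<comment> \<open>Only a supremum over the empty set could be \<open>-\<infinity>\<close>, and
      the pair \<open>(0, 0)\<close> is always admissible.\<close>
    case MInf
    have "0 \<in> ?K" "0 \<in> ?E"
      using assms subspace_0[OF assms(1)] lp_norm_scaleR[OF assms(6), of 0 "0 :: real ^ 'm"]
      by (simp_all add: model_set_def uncertainty_set_def)
    then have "ereal \<bar>blinfun_apply Q 0 - R (observation l 0 + 0)\<bar> \<le> ?err R"
      unfolding worst_case_error_def by (intro SUP_upper2[of "(0, 0)"]) auto
    then show ?thesis using MInf by simp
  qed simp
  show "optimal_recovery_map Q l ?K ?E (\<lambda>y. \<Sum>i\<in>UNIV. aopt $ i * y $ i)"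
    \<comment> \<open>The number \<open>\<epsilon> * ?obj aopt\<close> separates the error of the
      linear map from that of every other map.\<close>
    unfolding inner optimal_recovery_map_def
    using upper lower by (intro antisym INF_greatest INF_lower) (auto intro: order_trans)
qed

end
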